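(* Let $u, v \in A^*$. Then $u \equiv_{\mathrm{B}} v$ if and only if $\mathsf{P}(u) = \mathsf{P}(v)$.
   Context: $A = \{a_1 < a_2 < \cdots\}$ is a totally ordered infinite alphabet and $A^*$ is the free monoid of words on $A$. A congruence on $A^*$ is an equivalence relation compatible with concatenation. The Baxter congruence $\equiv_{\mathrm{B}}$ is the smallest congruence on $A^*$ such that, for all words $u, v \in A^*$ and letters $a,b,c,d \in A$: $\; c\,u\,a d\,v\,b \equiv_{\mathrm{B}} c\,u\,d a\,v\,b$ whenever $a \leq b < c \leq d$, and $\; b\,u\,d a\,v\,c \equiv_{\mathrm{B}} b\,u\,a d\,v\,c$ whenever $a < b \leq c < d$. A binary tree is either empty (a leaf) or a node with a left and a right binary subtree. A binary tree with nodes labeled by $A$ is a right (resp. left) binary search tree if for every node $x$ labeled by $b$, every label $a$ in the left subtree of $x$ and every label $c$ in the right subtree of $x$, one has $a \leq b < c$ (resp. $a < b \leq c$). The leaf insertion of a letter $a$ into a right (resp. left) binary search tree $T$: if $T$ is empty, return the one-node tree labeled $a$; otherwise, with $b$ the label of the root of $T$, if $a \leq b$ (resp. $a < b$) recursively leaf insert $a$ into the left subtree of $T$, and otherwise recursively leaf insert $a$ into the right subtree. The Baxter $\mathsf{P}$-symbol of $u \in A^*$ is the pair $\mathsf{P}(u) = (T_L, T_R)$ of labeled trees, where $T_L$ (resp. $T_R$) is the left (resp. right) binary search tree obtained by leaf inserting the letters of $u$ from left to right (resp. from right to left), starting from the empty tree. *)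

theory Defs
  imports Main "HOL-Library.Tree"
begin

text \<open>Words are lists, and concatenation is \<open>@\<close>.\<close>

text \<open>The smallest congruence containing the two Baxter adjacency relations: the first four
  rules close under equivalence and concatenation.\<close>

inductive baxter_equiv :: "'a::linorder list \<Rightarrow> 'a list \<Rightarrow> bool"  (infix \<open>\<equiv>\<^sub>B\<close> 50) where
  refl: "u \<equiv>\<^sub>B u"
| sym: "u \<equiv>\<^sub>B v \<Longrightarrow> v \<equiv>\<^sub>B u"
| trans: "u \<equiv>\<^sub>B v \<Longrightarrow> v \<equiv>\<^sub>B w \<Longrightarrow> u \<equiv>\<^sub>B w"
| append: "u \<equiv>\<^sub>B u' \<Longrightarrow> v \<equiv>\<^sub>B v' \<Longrightarrow> u @ v \<equiv>\<^sub>B u' @ v'"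
| adjacent1: "a \<le> b \<Longrightarrow> b < c \<Longrightarrow> c \<le> d \<Longrightarrow>
    [c] @ u @ [a, d] @ v @ [b] \<equiv>\<^sub>B [c] @ u @ [d, a] @ v @ [b]"
| adjacent2: "a < b \<Longrightarrow> b \<le> c \<Longrightarrow> c < d \<Longrightarrow>
    [b] @ u @ [d, a] @ v @ [c] \<equiv>\<^sub>B [b] @ u @ [a, d] @ v @ [c]"

fun left_bst :: "'a::linorder tree \<Rightarrow> bool" where
  "left_bst \<langle>\<rangle> \<longleftrightarrow> True"
| "left_bst \<langle>l, b, r\<rangle> \<longleftrightarrow>
    (\<forall>a\<in>set_tree l. a < b) \<and> (\<forall>c\<in>set_tree r. b \<le> c) \<and> left_bst l \<and> left_bst r"

fun right_bst :: "'a::linorder tree \<Rightarrow> bool" where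
  "right_bst \<langle>\<rangle> \<longleftrightarrow> True"
| "right_bst \<langle>l, b, r\<rangle> \<longleftrightarrow>
    (\<forall>a\<in>set_tree l. a \<le> b) \<and> (\<forall>c\<in>set_tree r. b < c) \<and> right_bst l \<and> right_bst r"

fun left_insert :: "'a::linorder \<Rightarrow> 'a tree \<Rightarrow> 'a tree" where
  "left_insert a \<langle>\<rangle> = \<langle>\<langle>\<rangle>, a, \<langle>\<rangle>\<rangle>"
| "left_insert a \<langle>l, b, r\<rangle> =
    (if a < b then \<langle>left_insert a l, b, r\<rangle> else \<langle>l, b, left_insert a r\<rangle>)"

fun right_insert :: "'a::linorder \<Rightarrow> 'a tree \<Rightarrow> 'a tree" where
  "right_insert a \<langle>\<rangle> = \<langle>\<langle>\<rangle>, a, \<langle>\<rangle>\<rangle>"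
| "right_insert a \<langle>l, b, r\<rangle> =
    (if a \<le> b then \<langle>right_insert a l, b, r\<rangle> else \<langle>l, b, right_insert a r\<rangle>)"

text \<open>\<open>fold\<close> inserts the letters from left to right, \<open>foldr\<close> from right to left.\<close>

definition baxter_P :: "'a::linorder list \<Rightarrow> 'a tree \<times> 'a tree" where
  "baxter_P u = (fold left_insert u \<langle>\<rangle>, foldr right_insert u \<langle>\<rangle>)"

text \<open>The insertions are total functions on all trees; they preserve the respective search tree
  property, so both components of the symbol are search trees of the intended kind.\<close>

lemma set_left_insert: "set_tree (left_insert a t) = insert a (set_tree t)"
  by (induction t) auto

lemma set_right_insert: "set_tree (right_insert a t) = insert a (set_tree t)"
  by (induction t) auto

lemma left_bst_left_insert: "left_bst t \<Longrightarrow> left_bst (left_insert a t)"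
  by (induction t) (auto simp: set_left_insert)

lemma right_bst_right_insert: "right_bst t \<Longrightarrow> right_bst (right_insert a t)"
  by (induction t) (auto simp: set_right_insert)

lemma left_bst_fold: "left_bst t \<Longrightarrow> left_bst (fold left_insert u t)"
  by (induction u arbitrary: t) (auto simp: left_bst_left_insert)

lemma left_bst_baxter_P: "left_bst (fst (baxter_P u))"
  by (simp add: baxter_P_def left_bst_fold)

lemma right_bst_baxter_P: "right_bst (snd (baxter_P u))"
proof -
  have "right_bst (foldr right_insert u \<langle>\<rangle>)"
    by (induction u) (auto simp: right_bst_right_insert)
  then show ?thesis
    by (simp add: baxter_P_def)
qed

end

theory Submission
  imports Defs "HOL-Library.Tree_Multiset"
begin

text \<open>Swapping two adjacent letters \<open>x\<close>, \<open>y\<close> does not change the tree inserted from the left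
  (right) as soon as an earlier (later) letter \<open>z\<close> sends \<open>x\<close> and \<open>y\<close> into different subtrees, and a
  swap with a separating letter on both sides is exactly one of the two adjacency relations.
  Conversely, suppose that \<open>p @ x # u\<close> and \<open>p @ v\<close> have the same symbol, and let \<open>v = v\<^sub>1 @ x # v\<^sub>2\<close>
  with \<open>x \<notin> set v\<^sub>1\<close>. Following \<open>x\<close> and \<open>y \<in> set v\<^sub>1\<close> down the two trees, they are separated by
  some letter of \<open>p\<close> and by some letter of \<open>v\<^sub>2\<close>. So \<open>x\<close> can be moved to the left through \<open>v\<^sub>1\<close>
  by adjacency relations, and one continues with \<open>p @ [x]\<close> in place of \<open>p\<close>.\<close>

text \<open>Taking the comparison as a parameter handles both trees at once: \<open>(<)\<close>
  gives the left tree, \<open>(\<le>)\<close> on the reversed word the right one.\<close>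

fun tree_insert :: "('a \<Rightarrow> 'a \<Rightarrow> bool) \<Rightarrow> 'a \<Rightarrow> 'a tree \<Rightarrow> 'a tree" where
  "tree_insert L a \<langle>\<rangle> = \<langle>\<langle>\<rangle>, a, \<langle>\<rangle>\<rangle>"
| "tree_insert L a \<langle>l, b, r\<rangle> =
    (if L a b then \<langle>tree_insert L a l, b, r\<rangle> else \<langle>l, b, tree_insert L a r\<rangle>)"

definition insert_word :: "('a \<Rightarrow> 'a \<Rightarrow> bool) \<Rightarrow> 'a list \<Rightarrow> 'a tree" where
  "insert_word L w = fold (tree_insert L) w \<langle>\<rangle>"

lemma left_insert_eq: "left_insert = tree_insert (<)"
proof (intro ext)
  fix a :: 'a and t
  show "left_insert a t = tree_insert (<) a t" by (induction t) auto
qed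

lemma right_insert_eq: "right_insert = tree_insert (\<le>)"
proof (intro ext)
  fix a :: 'a and t
  show "right_insert a t = tree_insert (\<le>) a t" by (induction t) auto
qed

lemma baxter_P_eq: "baxter_P u = (insert_word (<) u, insert_word (\<le>) (rev u))"
  by (simp add: baxter_P_def insert_word_def left_insert_eq right_insert_eq foldr_conv_fold)

lemma mset_tree_insert: "mset_tree (tree_insert L a t) = add_mset a (mset_tree t)"
  by (induction t) auto

lemma mset_insert_word: "mset_tree (insert_word L w) = mset w"
proof -
  have "mset_tree (fold (tree_insert L) w t) = mset w + mset_tree t" for t
    by (induction w arbitrary: t) (auto simp: mset_tree_insert)
  then show ?thesis by (simp add: insert_word_def)
qed

lemma fold_tree_insert_Node:
  "fold (tree_insert L) w \<langle>l, b, r\<rangle> =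
    \<langle>fold (tree_insert L) [a\<leftarrow>w. L a b] l, b, fold (tree_insert L) [a\<leftarrow>w. \<not> L a b] r\<rangle>"
  by (induction w arbitrary: l r) auto

text \<open>Trades recursion on trees for recursion on words: each subtree is again the tree of a
  subword, which allows induction on the length of a word.\<close>

lemma insert_word_Cons:
  "insert_word L (b # w) = \<langle>insert_word L [a\<leftarrow>w. L a b], b, insert_word L [a\<leftarrow>w. \<not> L a b]\<rangle>"
  by (simp add: insert_word_def fold_tree_insert_Node)

text \<open>By \<open>convex\<close>, a root that does not separate \<open>x\<close> and
  \<open>y\<close> sends \<open>z\<close> to their side too, so \<open>z\<close> survives in the
  subword that contains both.\<close>

lemma insert_word_swap:
  assumes convex: "\<And>a b d z. L a b = L d b \<Longrightarrow> L a z \<noteq> L d z \<Longrightarrow> L z b = L a b"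
    and "z \<in> set p" "L x z \<noteq> L y z"
  shows "insert_word L (p @ x # y # t) = insert_word L (p @ y # x # t)"
  using assms(2-)
proof (induction "length p" arbitrary: p t rule: less_induct)
  case less
  then obtain b p' where p: "p = b # p'" by (cases p) auto
  show ?case
  proof (cases "L x b = L y b")
    case False
    \<comment> \<open>Each subword receives only one of the two swapped letters, so their order is
      lost.\<close>
    then show ?thesis by (auto simp: p insert_word_Cons)
  next
    case True
    then have z: "L z b = L x b" and "z \<noteq> b" using convex less.prems(2) by blast+
    then have "z \<in> set p'" using less.prems(1) p by auto
    show ?thesis
    proof (cases "L x b")
      case T: True
      have "length [a\<leftarrow>p'. L a b] < length p" by (simp add: p le_imp_less_Suc)
      from less.hyps[OF this, of "[a\<leftarrow>t. L a b]"] show ?thesis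
        using T True z \<open>z \<in> set p'\<close> less.prems(2) by (simp add: p insert_word_Cons)
    next
      case F: False
      have "length [a\<leftarrow>p'. \<not> L a b] < length p" by (simp add: p le_imp_less_Suc)
      from less.hyps[OF this, of "[a\<leftarrow>t. \<not> L a b]"] show ?thesis
        using F True z \<open>z \<in> set p'\<close> less.prems(2) by (simp add: p insert_word_Cons)
    qed
  qed
qed

text \<open>The counts make the displayed \<open>x\<close> the same occurrence in both words, with
  more copies of \<open>y\<close> before it in the first. If no letter of \<open>t\<close> separated
  \<open>x\<close> from \<open>y\<close>, filtering would preserve these counts all the way down
  until \<open>t\<close> is empty.\<close>

lemma insert_word_separates:
  assumes "insert_word L (s @ x # u) = insert_word L (t @ x # v)"
    and "count_list s x = count_list t x" and "count_list t y < count_list s y"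
  shows "\<exists>z\<in>set t. L x z \<noteq> L y z"
  using assms
proof (induction "length t" arbitrary: s t u v rule: less_induct)
  case less
  obtain b s' where s: "s = b # s'" using less.prems(3) by (cases s) auto
  show ?case
  proof (cases t)
    case Nil
    \<comment> \<open>Equal roots give \<open>b = x\<close>, although \<open>x\<close> occurs in
      \<open>s\<close> as often as in the empty word.\<close>
    then show ?thesis using less.prems(1,2) by (auto simp: s insert_word_Cons)
  next
    case (Cons b' t')
    then have t: "t = b # t'" using less.prems(1) by (simp add: s insert_word_Cons)
    have cnt: "count_list s' x = count_list t' x" "count_list t' y < count_list s' y"
      using less.prems(2,3) by (auto simp: s t split: if_splits)
    have filt: "count_list (filter Q w) a = count_list w a" if "Q a" for Q w and a :: 'a
      using that by (induction w) auto
    have eqs: "insert_word L [a\<leftarrow>s' @ x # u. L a b] = insert_word L [a\<leftarrow>t' @ x # v. L a b]"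
      "insert_word L [a\<leftarrow>s' @ x # u. \<not> L a b] = insert_word L [a\<leftarrow>t' @ x # v. \<not> L a b]"
      using less.prems(1) by (simp_all add: s t insert_word_Cons)
    show ?thesis
    proof (rule ccontr)
      assume neg: "\<not> ?thesis"
      then have xy: "L x b = L y b" by (simp add: t)
      show False
      proof (cases "L x b")
        case True
        have "length [a\<leftarrow>t'. L a b] < length t" by (simp add: t le_imp_less_Suc)
        from less.hyps[OF this, of "[a\<leftarrow>s'. L a b]" "[a\<leftarrow>u. L a b]" "[a\<leftarrow>v. L a b]"]
        show False using True xy eqs(1) cnt neg by (auto simp: t filt)
      next
        case False
        have "length [a\<leftarrow>t'. \<not> L a b] < length t" by (simp add: t le_imp_less_Suc)
        from less.hyps[OF this, of "[a\<leftarrow>s'. \<not> L a b]" "[a\<leftarrow>u. \<not> L a b]" "[a\<leftarrow>v. \<not> L a b]"]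
        show False using False xy eqs(2) cnt neg by (auto simp: t filt)
      qed
    qed
  qed
qed

lemma baxter_P_swap:
  fixes x y :: "'a::linorder"
  assumes "z \<in> set p" "(x < z) \<noteq> (y < z)" "z' \<in> set t" "(x \<le> z') \<noteq> (y \<le> z')"
  shows "baxter_P (p @ x # y # t) = baxter_P (p @ y # x # t)"
proof -
  have "insert_word (<) (p @ x # y # t) = insert_word (<) (p @ y # x # t)"
    by (rule insert_word_swap[where z = z]) (use assms in auto)
  moreover have "insert_word (\<le>) (rev t @ y # x # rev p) = insert_word (\<le>) (rev t @ x # y # rev p)"
    by (rule insert_word_swap[where z = z']) (use assms in auto)
  ultimately show ?thesis by (simp add: baxter_P_eq)
qed

text \<open>The contexts \<open>p\<close>, \<open>s\<close> make the case of the rule \<open>append\<close> trivial.\<close>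

lemma baxter_equiv_imp_baxter_P_eq:
  "u \<equiv>\<^sub>B v \<Longrightarrow> baxter_P (p @ u @ s) = baxter_P (p @ v @ s)"
proof (induction arbitrary: p s rule: baxter_equiv.induct)
  case (append u u' v v')
  then show ?case by (metis append_assoc)
next
  case (adjacent1 a b c d u v)
  then show ?case
    using baxter_P_swap[of c "p @ c # u" a d b "v @ b # s"] by force
next
  case (adjacent2 a b c d u v)
  then show ?case
    using baxter_P_swap[of b "p @ b # u" d a c "v @ c # s"] by force
qed auto

lemma baxter_equiv_swap_less:
  fixes a d :: "'a::linorder"
  assumes "z \<in> set p" "a < z" "z \<le> d" "z' \<in> set t" "a \<le> z'" "z' < d"
  shows "p @ a # d # t \<equiv>\<^sub>B p @ d # a # t"
proof -
  obtain p1 p2 where p: "p = p1 @ z # p2" using assms by (auto dest: split_list)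
  obtain t1 t2 where t: "t = t1 @ z' # t2" using assms by (auto dest: split_list)
  have mid: "[z] @ p2 @ [a, d] @ t1 @ [z'] \<equiv>\<^sub>B [z] @ p2 @ [d, a] @ t1 @ [z']"
  \<comment> \<open>Both separators lie between \<open>a\<close> and \<open>d\<close>; their mutual
    order decides which adjacency relation applies.\<close>
  proof (cases "z' < z")
    case True
    then show ?thesis using assms by (intro baxter_equiv.adjacent1) auto
  next
    case False
    then show ?thesis
      using assms by (intro baxter_equiv.sym[OF baxter_equiv.adjacent2]) auto
  qed
  have "p1 @ ([z] @ p2 @ [a, d] @ t1 @ [z']) @ t2 \<equiv>\<^sub>B p1 @ ([z] @ p2 @ [d, a] @ t1 @ [z']) @ t2"
    by (intro baxter_equiv.append baxter_equiv.refl mid)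
  then show ?thesis by (simp add: p t)
qed

lemma baxter_equiv_swap:
  fixes x y :: "'a::linorder"
  assumes "z \<in> set p" "(x < z) \<noteq> (y < z)" "z' \<in> set t" "(x \<le> z') \<noteq> (y \<le> z')"
  shows "p @ x # y # t \<equiv>\<^sub>B p @ y # x # t"
proof (cases "x < y")
  case True
  with assms show ?thesis by (intro baxter_equiv_swap_less[of z _ _ _ z']) auto
next
  case False
  with assms show ?thesis
    by (intro baxter_equiv.sym[OF baxter_equiv_swap_less[of z _ _ _ z']]) auto
qed

lemma baxter_equiv_move_left:
  fixes x :: "'a::linorder"
  assumes "\<And>y. y \<in> set w \<Longrightarrow> \<exists>z\<in>set p. (x < z) \<noteq> (y < z)"
    and "\<And>y. y \<in> set w \<Longrightarrow> \<exists>z\<in>set t. (x \<le> z) \<noteq> (y \<le> z)"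
  shows "p @ w @ x # t \<equiv>\<^sub>B p @ x # w @ t"
  using assms
proof (induction w arbitrary: t rule: rev_induct)
  case Nil
  show ?case by (simp add: baxter_equiv.refl)
next
  case (snoc y w)
  obtain z z' where "z \<in> set p" "(x < z) \<noteq> (y < z)" "z' \<in> set t" "(x \<le> z') \<noteq> (y \<le> z')"
    using snoc.prems by (metis in_set_conv_decomp)
  then have "(p @ w) @ y # x # t \<equiv>\<^sub>B (p @ w) @ x # y # t"
    by (intro baxter_equiv_swap[of z _ _ _ z']) auto
  \<comment> \<open>The letter \<open>y\<close>, already passed by \<open>x\<close>, joins the
    suffix.\<close>
  moreover have "p @ w @ x # (y # t) \<equiv>\<^sub>B p @ x # w @ (y # t)"
    by (rule snoc.IH) (use snoc.prems in auto)
  ultimately show ?case using baxter_equiv.trans by auto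
qed

lemma baxter_P_eq_imp_baxter_equiv:
  "baxter_P (p @ u) = baxter_P (p @ v) \<Longrightarrow> p @ u \<equiv>\<^sub>B p @ v"
proof (induction u arbitrary: p v)
  case Nil
  then have "mset (p @ []) = mset (p @ v)" by (metis baxter_P_eq mset_insert_word prod.inject)
  then show ?case by (simp add: baxter_equiv.refl)
next
  case (Cons x u)
  have L: "insert_word (<) (p @ v) = insert_word (<) (p @ x # u)"
    and R: "insert_word (\<le>) (rev (p @ x # u)) = insert_word (\<le>) (rev (p @ v))"
    using Cons.prems by (simp_all add: baxter_P_eq)
  have "mset (p @ v) = mset (p @ x # u)" using L by (metis mset_insert_word)
  then have m: "mset v = mset (x # u)" by simp
  then have "x \<in> set v" using mset_eq_setD by fastforce
  then obtain v1 v2 where v: "v = v1 @ x # v2" and x: "x \<notin> set v1"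
    using split_list_first by metis
  \<comment> \<open>For the right tree: \<open>u\<close> and \<open>v2\<close> contain
    \<open>x\<close> equally often, while \<open>u\<close> has extra copies of every letter of
    \<open>v1\<close>.\<close>
  have cnt: "count_list u a = count_list v1 a + count_list v2 a" for a
    using arg_cong[OF m, of "\<lambda>M. count M a"]
    by (simp add: v count_mset split: if_splits)
  have "p @ v1 @ x # v2 \<equiv>\<^sub>B p @ x # v1 @ v2"
  proof (rule baxter_equiv_move_left)
    fix y assume "y \<in> set v1"
    then have y: "0 < count_list v1 y" by (metis count_list_0_iff gr0I)
    have x0: "count_list v1 x = 0" using x by (simp add: count_list_0_iff)
    show "\<exists>z\<in>set p. (x < z) \<noteq> (y < z)"
      by (rule insert_word_separates[of _ "p @ v1" _ v2 _ u]) (use L x0 y in \<open>simp_all add: v\<close>)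
    have "\<exists>z\<in>set (rev v2). (x \<le> z) \<noteq> (y \<le> z)"
      by (rule insert_word_separates[of _ "rev u" _ "rev p" _ "rev v1 @ rev p"])
        (use R x0 y cnt in \<open>simp_all add: v\<close>)
    then show "\<exists>z\<in>set v2. (x \<le> z) \<noteq> (y \<le> z)" by simp
  qed
  then have move: "p @ v \<equiv>\<^sub>B (p @ [x]) @ v1 @ v2" by (simp add: v)
  \<comment> \<open>The implication already proved shows that the move keeps the symbol, so the
    induction hypothesis applies with the longer prefix.\<close>
  then have "baxter_P (p @ v) = baxter_P ((p @ [x]) @ v1 @ v2)"
    using baxter_equiv_imp_baxter_P_eq[of _ _ "[]" "[]"] by simp
  then have "(p @ [x]) @ u \<equiv>\<^sub>B (p @ [x]) @ v1 @ v2"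
    using Cons.prems by (intro Cons.IH) simp
  then show ?case using move baxter_equiv.sym baxter_equiv.trans by fastforce
qed

theorem theorem4p6:
  fixes letter :: "nat \<Rightarrow> 'a::linorder" and u v :: "'a list"
  assumes "strict_mono letter" and "range letter = UNIV"
  shows "u \<equiv>\<^sub>B v \<longleftrightarrow> baxter_P u = baxter_P v"
  using baxter_equiv_imp_baxter_P_eq[of u v "[]" "[]"] baxter_P_eq_imp_baxter_equiv[of "[]" u v]
  by auto

end
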